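(* Let $M$ be a special (pseudo-)Kähler manifold of real dimension $2n$ described locally by flat coordinates $x_1,\dots,x_{2n}$, constant symplectic matrix $(\omega_{jk})$ and function $\phi(x_1,\dots,x_{2n})$, with metric $\sum\frac{\partial^2\phi}{\partial x_j\partial x_k}dx_jdx_k$. On $M\times\mathbf{R}^{2n}$, with coordinates $y_1,\dots,y_{2n}$ on $\mathbf{R}^{2n}$, consider the hyperkähler metric defined by the three symplectic forms $$\omega_1=\sum_{j,k}\frac{\partial^2\phi}{\partial x_j\partial x_k}dx_j\wedge dy_k,\qquad \omega_2+i\omega_3=-\frac12\sum_{j,k}\omega_{jk}\,d(x_j+iy_j)\wedge d(x_k+iy_k).$$ Then $\phi$ (pulled back to $M\times\mathbf{R}^{2n}$) is a Kähler potential for this metric with respect to the complex structure $J_1$; that is, $\omega_1$ is a nonzero real constant multiple of $i\partial\bar\partial\phi$, where $\partial,\bar\partial$ are taken with respect to $J_1$.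
   Context: A special Kähler manifold is a complex manifold $(M,I)$ with a Kähler metric $g$ (allowed to be indefinite in the pseudo case) with Kähler form $\omega$, and a flat torsion-free connection $\nabla$ with $\nabla\omega=0$ and $d_\nabla I=0\in\Omega^2(M,T)$ ($I$ regarded as a $T$-valued 1-form). Locally there are flat coordinates $x_j$ in which $\nabla$ is ordinary differentiation and the symplectic form has a constant matrix $(\omega_{jk})$ with inverse $(\omega^{jk})$. There is also a function $\phi$ with $g_{jk}=\partial^2\phi/\partial x_j\partial x_k$, and $I^j_k=\sum_a\omega^{ja}g_{ak}$ satisfies $I^2=-1$. Three symplectic forms $\omega_1,\omega_2,\omega_3$ define a (pseudo-)hyperkähler metric if the following holds: with $\varphi_i:T\to T^*$ the isomorphism determined by $\omega_i$, the endomorphisms $J_1=\varphi_3^{-1}\varphi_2$, $J_2=\varphi_1^{-1}\varphi_3$, $J_3=\varphi_2^{-1}\varphi_1$ satisfy the quaternionic identities. The forms $\omega_1,\omega_2,\omega_3$ are then the Kähler forms for $J_1,J_2,J_3$. The forms in the claim satisfy this. The complex structure $J_1$ is the one for which $z_j=x_j+iy_j$ ($1\le j\le 2n$) are holomorphic coordinates. *)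

theory Defs
  imports "HOL-Analysis.Analysis"
begin

primrec times_cont_diff_on ::
  "nat \<Rightarrow> 'a::real_normed_vector set \<Rightarrow> ('a \<Rightarrow> 'b::real_normed_vector) \<Rightarrow> bool" where
  "times_cont_diff_on 0 S f \<longleftrightarrow> continuous_on S f"
| "times_cont_diff_on (Suc k) S f \<longleftrightarrow>
     (\<forall>x\<in>S. f differentiable (at x)) \<and>
     (\<forall>v. times_cont_diff_on k S (\<lambda>x. frechet_derivative f (at x) v))"

text \<open>Meant for open sets and finite-dimensional domains, since derivatives are taken
  at full neighbourhoods and tested one direction at a time.\<close>

definition smooth_on :: "'a::real_normed_vector set \<Rightarrow> ('a \<Rightarrow> 'b::real_normed_vector) \<Rightarrow> bool" where
  "smooth_on S f \<longleftrightarrow> (\<forall>k. times_cont_diff_on k S f)"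

definition partial :: "'d \<Rightarrow> (real^'d::finite \<Rightarrow> real) \<Rightarrow> real^'d \<Rightarrow> real" where
  "partial j f x = frechet_derivative f (at x) (axis j 1)"

definition hessian :: "(real^'d::finite \<Rightarrow> real) \<Rightarrow> real^'d \<Rightarrow> real^'d^'d" where
  "hessian f x = (\<chi> j k. partial j (partial k f) x)"


text \<open>The index type \<open>'n + 'n\<close> has \<open>2 * CARD('n)\<close> elements, so \<open>real^('n + 'n)\<close> is
  \<open>2n\<close>-dimensional Euclidean space with \<open>n = CARD('n)\<close>.  Endomorphism fields and bilinear forms
  are given by their coefficient matrices, \<open>Ic x $ j $ k\<close> being the coefficient with upper index \<open>j\<close>
  and lower index \<open>k\<close>.\<close>

definition complex_structure_on ::
  "(real^('n::finite + 'n)) set \<Rightarrow> (real^('n + 'n) \<Rightarrow> real^('n + 'n)^('n + 'n)) \<Rightarrow> bool" where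
  "complex_structure_on U Ic \<longleftrightarrow>
     (\<forall>j k. smooth_on U (\<lambda>x. Ic x $ j $ k)) \<and>
     (\<forall>x\<in>U. Ic x ** Ic x = - mat 1) \<and>
     (\<forall>x\<in>U. \<exists>V (F :: real^('n + 'n) \<Rightarrow> complex^'n).
        open V \<and> x \<in> V \<and> V \<subseteq> U \<and> smooth_on V F \<and> inj_on F V \<and> open (F ` V) \<and>
        (\<forall>q\<in>V. bij (frechet_derivative F (at q)) \<and>
           (\<forall>X. frechet_derivative F (at q) (Ic q *v X) = \<i> *s frechet_derivative F (at q) X)))"

text \<open>No definiteness is required: indefinite signatures are allowed.\<close>

definition hermitian_pseudo_metric_on ::
  "(real^'d::finite) set \<Rightarrow> (real^'d \<Rightarrow> real^'d^'d) \<Rightarrow> (real^'d \<Rightarrow> real^'d^'d) \<Rightarrow> bool" where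
  "hermitian_pseudo_metric_on U Ic g \<longleftrightarrow>
     (\<forall>j k. smooth_on U (\<lambda>x. g x $ j $ k)) \<and>
     (\<forall>x\<in>U. transpose (g x) = g x \<and> invertible (g x) \<and>
            transpose (Ic x) ** g x ** Ic x = g x)"

text \<open>The connection is ordinary differentiation in the coordinates of \<open>U\<close>, hence flat and
  torsion-free; it makes the Kaehler form parallel exactly when the coefficient matrix \<open>om\<close> of that
  form is constant.  The equation \<open>om = transpose (Ic x) ** g x\<close> says \<open>\<omega>(X, Y) = g(I X, Y)\<close>,
  which for hermitian \<open>g\<close> is the convention \<open>I = \<omega>\<^sup>-\<^sup>1 g\<close>.  The last clause says that the
  covariant exterior derivative of the tangent-valued 1-form \<open>Ic\<close> vanishes.\<close>

definition special_pseudo_kaehler_on ::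
  "(real^('n::finite + 'n)) set \<Rightarrow> (real^('n + 'n) \<Rightarrow> real^('n + 'n)^('n + 'n)) \<Rightarrow>
   (real^('n + 'n) \<Rightarrow> real^('n + 'n)^('n + 'n)) \<Rightarrow> real^('n + 'n)^('n + 'n) \<Rightarrow> bool" where
  "special_pseudo_kaehler_on U Ic g om \<longleftrightarrow>
     open U \<and> complex_structure_on U Ic \<and> hermitian_pseudo_metric_on U Ic g \<and>
     transpose om = - om \<and> invertible om \<and>
     (\<forall>x\<in>U. om = transpose (Ic x) ** g x) \<and>
     (\<forall>x\<in>U. \<forall>j k l. partial k (\<lambda>y. Ic y $ j $ l) x = partial l (\<lambda>y. Ic y $ j $ k) x)"


text \<open>A \<open>k\<close>-form on (an open subset of) \<open>'a\<close> is a function of a point and \<open>k\<close> tangent vectors.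
  The wedge product is normalised by \<open>(\<alpha> \<and> \<beta>)(u, v) = \<alpha>(u) \<beta>(v) - \<alpha>(v) \<beta>(u)\<close>.\<close>

definition wedge ::
  "('a \<Rightarrow> 'a \<Rightarrow> 'b::real_normed_field) \<Rightarrow> ('a \<Rightarrow> 'a \<Rightarrow> 'b) \<Rightarrow> 'a \<Rightarrow> 'a \<Rightarrow> 'a \<Rightarrow> 'b" where
  "wedge a b p u v = a p u * b p v - a p v * b p u"

definition ext_d0 ::
  "('a::real_normed_vector \<Rightarrow> 'b::real_normed_field) \<Rightarrow> 'a \<Rightarrow> 'a \<Rightarrow> 'b" where
  "ext_d0 f p v = frechet_derivative f (at p) v"

definition ext_d1 ::
  "('a::real_normed_vector \<Rightarrow> 'a \<Rightarrow> 'b::real_normed_field) \<Rightarrow> 'a \<Rightarrow> 'a \<Rightarrow> 'a \<Rightarrow> 'b" where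
  "ext_d1 a p u v =
     frechet_derivative (\<lambda>q. a q v) (at p) u - frechet_derivative (\<lambda>q. a q u) (at p) v"

definition ext_d2 ::
  "('a::real_normed_vector \<Rightarrow> 'a \<Rightarrow> 'a \<Rightarrow> 'b::real_normed_field) \<Rightarrow> 'a \<Rightarrow> 'a \<Rightarrow> 'a \<Rightarrow> 'a \<Rightarrow> 'b" where
  "ext_d2 w p s u v =
     frechet_derivative (\<lambda>q. w q u v) (at p) s - frechet_derivative (\<lambda>q. w q s v) (at p) u
     + frechet_derivative (\<lambda>q. w q s u) (at p) v"

definition symplectic_form_on ::
  "'a::euclidean_space set \<Rightarrow> ('a \<Rightarrow> 'a \<Rightarrow> 'a \<Rightarrow> real) \<Rightarrow> bool" where
  "symplectic_form_on W w \<longleftrightarrow>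
     (\<forall>u v. smooth_on W (\<lambda>p. w p u v)) \<and>
     (\<forall>p\<in>W. bilinear (w p) \<and> (\<forall>u. w p u u = 0) \<and>
            (\<forall>u. (\<forall>v. w p u v = 0) \<longrightarrow> u = 0) \<and>
            (\<forall>s u v. ext_d2 w p s u v = 0))"

text \<open>The Dolbeault operators of an endomorphism field \<open>J\<close>: \<open>dbar_fun\<close> is the (0,1)-part of
  the exterior derivative on functions, and \<open>del_01\<close> is the (1,1)-part of the exterior derivative
  on (0,1)-forms.\<close>

definition part_01 ::
  "('a \<Rightarrow> 'a \<Rightarrow> 'a) \<Rightarrow> ('a \<Rightarrow> 'a \<Rightarrow> complex) \<Rightarrow> 'a \<Rightarrow> 'a \<Rightarrow> complex" where
  "part_01 J a p v = (a p v + \<i> * a p (J p v)) / 2"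

definition part_11 ::
  "('a \<Rightarrow> 'a \<Rightarrow> 'a) \<Rightarrow> ('a \<Rightarrow> 'a \<Rightarrow> 'a \<Rightarrow> complex) \<Rightarrow> 'a \<Rightarrow> 'a \<Rightarrow> 'a \<Rightarrow> complex" where
  "part_11 J w p u v = (w p u v + w p (J p u) (J p v)) / 2"

definition dbar_fun ::
  "('a::real_normed_vector \<Rightarrow> 'a \<Rightarrow> 'a) \<Rightarrow> ('a \<Rightarrow> complex) \<Rightarrow> 'a \<Rightarrow> 'a \<Rightarrow> complex" where
  "dbar_fun J f = part_01 J (ext_d0 f)"

definition del_01 ::
  "('a::real_normed_vector \<Rightarrow> 'a \<Rightarrow> 'a) \<Rightarrow> ('a \<Rightarrow> 'a \<Rightarrow> complex) \<Rightarrow> 'a \<Rightarrow> 'a \<Rightarrow> 'a \<Rightarrow> complex" where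
  "del_01 J b = part_11 J (ext_d1 b)"


text \<open>A 2-form at \<open>p\<close> is, by currying, the map from tangent vectors to cotangent vectors
  \<open>X \<mapsto> w p X\<close>.  Thus \<open>form_endo s t\<close> is the inverse of the map given by \<open>s\<close> after the map
  given by \<open>t\<close>; it is meaningful when \<open>s\<close> is nondegenerate, the dimension being finite.\<close>

definition form_endo ::
  "('a \<Rightarrow> 'a \<Rightarrow> 'a \<Rightarrow> real) \<Rightarrow> ('a \<Rightarrow> 'a \<Rightarrow> 'a \<Rightarrow> real) \<Rightarrow> 'a \<Rightarrow> 'a \<Rightarrow> 'a" where
  "form_endo s t p = inv (s p) \<circ> t p"

definition quaternionic :: "('a::real_vector \<Rightarrow> 'a) \<Rightarrow> ('a \<Rightarrow> 'a) \<Rightarrow> ('a \<Rightarrow> 'a) \<Rightarrow> bool" where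
  "quaternionic J1 J2 J3 \<longleftrightarrow>
     J1 \<circ> J1 = uminus \<and> J2 \<circ> J2 = uminus \<and> J3 \<circ> J3 = uminus \<and> J1 \<circ> J2 \<circ> J3 = uminus"

definition pseudo_hyperkaehler_forms_on ::
  "'a::euclidean_space set \<Rightarrow> ('a \<Rightarrow> 'a \<Rightarrow> 'a \<Rightarrow> real) \<Rightarrow> ('a \<Rightarrow> 'a \<Rightarrow> 'a \<Rightarrow> real) \<Rightarrow>
   ('a \<Rightarrow> 'a \<Rightarrow> 'a \<Rightarrow> real) \<Rightarrow> bool" where
  "pseudo_hyperkaehler_forms_on W w1 w2 w3 \<longleftrightarrow>
     symplectic_form_on W w1 \<and> symplectic_form_on W w2 \<and> symplectic_form_on W w3 \<and>
     (\<forall>p\<in>W. quaternionic (form_endo w3 w2 p) (form_endo w1 w3 p) (form_endo w2 w1 p))"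


definition xc :: "'d \<Rightarrow> (real^'d::finite) \<times> (real^'d) \<Rightarrow> real" where
  "xc j p = fst p $ j"

definition yc :: "'d \<Rightarrow> (real^'d::finite) \<times> (real^'d) \<Rightarrow> real" where
  "yc j p = snd p $ j"

definition zc :: "'d \<Rightarrow> (real^'d::finite) \<times> (real^'d) \<Rightarrow> complex" where
  "zc j p = complex_of_real (xc j p) + \<i> * complex_of_real (yc j p)"

type_synonym 'd real_two_form =
  "(real^'d) \<times> (real^'d) \<Rightarrow> (real^'d) \<times> (real^'d) \<Rightarrow> (real^'d) \<times> (real^'d) \<Rightarrow> real"

definition omega1 :: "(real^'d::finite \<Rightarrow> real) \<Rightarrow> 'd real_two_form" where
  "omega1 \<phi> p u v =
     (\<Sum>j\<in>UNIV. \<Sum>k\<in>UNIV. hessian \<phi> (fst p) $ j $ k * wedge (ext_d0 (xc j)) (ext_d0 (yc k)) p u v)"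

definition omega23 ::
  "real^'d^'d::finite \<Rightarrow> (real^'d) \<times> (real^'d) \<Rightarrow> (real^'d) \<times> (real^'d) \<Rightarrow> (real^'d) \<times> (real^'d) \<Rightarrow> complex" where
  "omega23 om p u v =
     - (1 / 2) * (\<Sum>j\<in>UNIV. \<Sum>k\<in>UNIV.
        complex_of_real (om $ j $ k) * wedge (ext_d0 (zc j)) (ext_d0 (zc k)) p u v)"

definition omega2 :: "real^'d^'d::finite \<Rightarrow> 'd real_two_form" where
  "omega2 om p u v = Re (omega23 om p u v)"

definition omega3 :: "real^'d^'d::finite \<Rightarrow> 'd real_two_form" where
  "omega3 om p u v = Im (omega23 om p u v)"

end

theory Submission
  imports Defs
begin

text \<open>
  Write tangent vectors of \<open>M \<times> \<real>\<^sup>2\<^sup>n\<close> as \<open>u = (a, b)\<close>, \<open>v = (c, d)\<close>, let \<open>G\<close> be the Hessian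
  of \<open>\<phi>\<close> and \<open>\<omega>\<close> the constant symplectic matrix.  Evaluating the wedge products
  gives
    \<^item> \<open>\<omega>\<^sub>1(u, v) = a \<bullet> G d - c \<bullet> G b\<close>,
    \<^item> \<open>\<omega>\<^sub>2(u, v) = b \<bullet> \<omega> d - a \<bullet> \<omega> c\<close>,
    \<^item> \<open>\<omega>\<^sub>3(u, v) = - (a \<bullet> \<omega> d) - b \<bullet> \<omega> c\<close>,
  after which almost everything is linear algebra at a point.

  The forms \<open>\<omega>\<^sub>2\<close> and \<open>\<omega>\<^sub>3\<close> have constant coefficients and are closed.  For \<open>\<omega>\<^sub>1\<close>, closedness
  means that the derivative of \<open>G\<close> is totally symmetric.  This follows from
  the special Kaehler condition (lemma \<open>codazzi\<close>): since \<open>G = \<omega> I\<close> with \<open>\<omega>\<close> constant, the equation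
  \<open>\<partial>\<^sub>k I\<^sup>j\<^sub>l = \<partial>\<^sub>l I\<^sup>j\<^sub>k\<close> carries over to \<open>G\<close>, and \<open>G\<close> is symmetric.

  The relation \<open>(I a) \<bullet> G d = a \<bullet> \<omega> d\<close> turns the endomorphisms defined by the forms
  into \<open>J\<^sub>1(a, b) = (- b, a)\<close>, \<open>J\<^sub>2(a, b) = (- I a, I b)\<close> and \<open>J\<^sub>3(a, b) = (- I b, - I a)\<close>, which are
  quaternionic because \<open>I\<^sup>2 = -1\<close>.

  As \<open>J\<^sub>1\<close> is constant and \<open>\<phi>\<close> depends on \<open>x\<close> only, the (0,1)-part of \<open>d\<phi>\<close> is
  \<open>v \<mapsto> (d\<phi>(c) - \<i> d\<phi>(d)) / 2\<close>.  Its exterior derivative consists of second derivatives of \<open>\<phi>\<close>: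
  the symmetric contribution \<open>a \<bullet> G c - c \<bullet> G a\<close> cancels, and the imaginary one is
  \<open>- \<i>/2 (a \<bullet> G d - c \<bullet> G b) = - \<i>/2 \<omega>\<^sub>1(u, v)\<close>.  This is already of type (1,1), so
  \<open>\<i> \<partial> \<partial>bar \<phi> = \<omega>\<^sub>1 / 2\<close>.
\<close>

section \<open>Smooth functions on open sets\<close>

text \<open>The derivatives are taken at full neighbourhoods, so only on an open set do they depend on
  nothing but the values on that set.\<close>

lemma times_cont_diff_on_cong:
  assumes "open S" "\<And>x. x \<in> S \<Longrightarrow> f x = g x" "times_cont_diff_on k S f"
  shows "times_cont_diff_on k S g"
  using assms
proof (induction k arbitrary: f g)
  case 0
  then show ?case by (simp cong: continuous_on_cong)
next
  case (Suc k)
  have d: "f differentiable (at x)" if "x \<in> S" for x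
    using Suc.prems that by simp
  have "g differentiable (at x)" if "x \<in> S" for x
    using d[OF that] Suc.prems(2) has_derivative_transform_within_open[OF _ \<open>open S\<close> that]
    unfolding differentiable_def by blast
  moreover have "frechet_derivative f (at x) v = frechet_derivative g (at x) v" if "x \<in> S" for x v
    using frechet_derivative_transform_within_open[OF d[OF that] \<open>open S\<close> that] Suc.prems(2) by simp
  ultimately show ?case
    using Suc.IH[OF \<open>open S\<close>, of "\<lambda>x. frechet_derivative f (at x) v"
        "\<lambda>x. frechet_derivative g (at x) v" for v] Suc.prems(3) by auto
qed

lemma smooth_on_cong:
  assumes "open S" "\<And>x. x \<in> S \<Longrightarrow> f x = g x" "smooth_on S f"
  shows "smooth_on S g"
  using assms times_cont_diff_on_cong unfolding smooth_on_def by blast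

lemma times_cont_diff_on_const: "times_cont_diff_on k S (\<lambda>x. c)"
  by (induction k arbitrary: c) auto

lemma smooth_on_const: "smooth_on S (\<lambda>x. c)"
  by (simp add: smooth_on_def times_cont_diff_on_const)

lemma frechet_derivative_add_at:
  assumes "f differentiable (at x)" "g differentiable (at x)"
  shows "frechet_derivative (\<lambda>x. f x + g x) (at x) v
    = frechet_derivative f (at x) v + frechet_derivative g (at x) v"
proof -
  have "((\<lambda>x. f x + g x) has_derivative
      (\<lambda>v. frechet_derivative f (at x) v + frechet_derivative g (at x) v)) (at x)"
    using assms by (intro has_derivative_add) (simp_all add: frechet_derivative_works[symmetric])
  then show ?thesis by (simp add: frechet_derivative_at[symmetric])
qed

lemma times_cont_diff_on_add:
  assumes "open S" "times_cont_diff_on k S f" "times_cont_diff_on k S g"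
  shows "times_cont_diff_on k S (\<lambda>x. f x + g x)"
  using assms
proof (induction k arbitrary: f g)
  case 0
  then show ?case by (simp add: continuous_on_add)
next
  case (Suc k)
  have "times_cont_diff_on k S (\<lambda>x. frechet_derivative f (at x) v + frechet_derivative g (at x) v)"
    for v
    using Suc.prems by (intro Suc.IH) auto
  from times_cont_diff_on_cong[OF \<open>open S\<close> _ this]
  have "times_cont_diff_on k S (\<lambda>x. frechet_derivative (\<lambda>x. f x + g x) (at x) v)" for v
    using Suc.prems by (simp add: frechet_derivative_add_at)
  then show ?case using Suc.prems by auto
qed

lemma smooth_on_add:
  "open S \<Longrightarrow> smooth_on S f \<Longrightarrow> smooth_on S g \<Longrightarrow> smooth_on S (\<lambda>x. f x + g x)"
  by (simp add: smooth_on_def times_cont_diff_on_add)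

lemma smooth_on_sum:
  assumes "open S" "\<And>i. i \<in> A \<Longrightarrow> smooth_on S (f i)"
  shows "smooth_on S (\<lambda>x. \<Sum>i\<in>A. f i x)"
  using assms
  by (induction A rule: infinite_finite_induct) (auto intro: smooth_on_const smooth_on_add)

text \<open>Linear maps commute with differentiation, so composing with one on either side, here with
  the projection on the right, preserves each class of differentiability.\<close>

lemma times_cont_diff_on_bounded_linear:
  assumes "open S" "bounded_linear h" "times_cont_diff_on k S f"
  shows "times_cont_diff_on k S (\<lambda>x. h (f x))"
  using assms
proof (induction k arbitrary: f)
  case 0
  then show ?case by (simp add: bounded_linear.continuous_on)
next
  case (Suc k)
  have D: "((\<lambda>x. h (f x)) has_derivative (\<lambda>v. h (frechet_derivative f (at x) v))) (at x)"
    if "x \<in> S" for x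
    using Suc.prems that by (auto intro: bounded_linear.has_derivative simp: frechet_derivative_works)
  have "times_cont_diff_on k S (\<lambda>x. h (frechet_derivative f (at x) v))" for v
    using Suc.prems by (intro Suc.IH) auto
  from times_cont_diff_on_cong[OF \<open>open S\<close> _ this]
  have "times_cont_diff_on k S (\<lambda>x. frechet_derivative (\<lambda>x. h (f x)) (at x) v)" for v
    by (simp add: frechet_derivative_at[OF D, symmetric])
  then show ?case using D by (auto intro: differentiableI)
qed

lemma times_cont_diff_on_comp_fst:
  fixes f :: "'a::real_normed_vector \<Rightarrow> 'b::real_normed_vector"
  assumes "open S" "times_cont_diff_on k S f"
  shows "times_cont_diff_on k (S \<times> (UNIV :: 'c::real_normed_vector set)) (\<lambda>p. f (fst p))"
  using assms
proof (induction k arbitrary: f)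
  case 0
  then show ?case by (auto intro!: continuous_intros continuous_on_compose2[of S f])
next
  case (Suc k)
  have o: "open (S \<times> (UNIV :: 'c set))" using \<open>open S\<close> by (simp add: open_Times)
  have D: "((\<lambda>p. f (fst p)) has_derivative (\<lambda>u. frechet_derivative f (at (fst p)) (fst u))) (at p)"
    if "p \<in> S \<times> UNIV" for p :: "'a \<times> 'c"
    using Suc.prems that
    by (intro has_derivative_compose[OF has_derivative_fst[OF has_derivative_ident]])
       (auto simp: frechet_derivative_works[symmetric])
  have "times_cont_diff_on k (S \<times> (UNIV :: 'c set)) (\<lambda>p. frechet_derivative f (at (fst p)) (fst u))"
    for u :: "'a \<times> 'c"
    by (rule Suc.IH[of "\<lambda>x. frechet_derivative f (at x) (fst u)"]) (use Suc.prems in auto)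
  from times_cont_diff_on_cong[OF o _ this]
  have "times_cont_diff_on k (S \<times> (UNIV :: 'c set)) (\<lambda>p. frechet_derivative (\<lambda>p. f (fst p)) (at p) u)"
    for u :: "'a \<times> 'c"
    by (simp add: frechet_derivative_at[OF D, symmetric])
  moreover have "(\<lambda>p. f (fst p)) differentiable (at p)" if "p \<in> S \<times> UNIV" for p :: "'a \<times> 'c"
    using D[OF that] by (rule differentiableI)
  ultimately show ?case by simp
qed

lemma smooth_on_bounded_linear:
  "open S \<Longrightarrow> bounded_linear h \<Longrightarrow> smooth_on S f \<Longrightarrow> smooth_on S (\<lambda>x. h (f x))"
  by (simp add: smooth_on_def times_cont_diff_on_bounded_linear)

lemma smooth_on_comp_fst: "open S \<Longrightarrow> smooth_on S f \<Longrightarrow> smooth_on (S \<times> UNIV) (\<lambda>p. f (fst p))"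
  by (simp add: smooth_on_def times_cont_diff_on_comp_fst)

lemma smooth_on_imp_differentiable: "smooth_on S f \<Longrightarrow> x \<in> S \<Longrightarrow> f differentiable (at x)"
  unfolding smooth_on_def by (metis times_cont_diff_on.simps(2))

lemma smooth_on_frechet_derivative:
  "smooth_on S f \<Longrightarrow> smooth_on S (\<lambda>x. frechet_derivative f (at x) v)"
  unfolding smooth_on_def by (metis times_cont_diff_on.simps(2))


section \<open>Derivatives in coordinates\<close>

lemma frechet_derivative_eq_sum_partial:
  fixes f :: "real^'d::finite \<Rightarrow> real"
  assumes "f differentiable (at x)"
  shows "frechet_derivative f (at x) v = (\<Sum>j\<in>UNIV. v $ j * partial j f x)"
proof -
  interpret linear "frechet_derivative f (at x)"
    using assms by (rule linear_frechet_derivative)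
  have "frechet_derivative f (at x) v = frechet_derivative f (at x) (\<Sum>j\<in>UNIV. v $ j *\<^sub>R axis j 1)"
    using basis_expansion[of v] by (simp add: scalar_mult_eq_scaleR)
  then show ?thesis by (simp add: sum scaleR partial_def)
qed

lemma partial_cong:
  assumes "open S" "x \<in> S" "\<And>y. y \<in> S \<Longrightarrow> f y = g y" "f differentiable (at x)"
  shows "partial j f x = partial j g x"
  using frechet_derivative_transform_within_open[OF assms(4,1,2)] assms(3)
  by (simp add: partial_def)

lemma partial_linear_combination:
  assumes "finite A" "\<And>i. i \<in> A \<Longrightarrow> f i differentiable (at x)"
  shows "partial j (\<lambda>y. \<Sum>i\<in>A. c i * f i y) x = (\<Sum>i\<in>A. c i * partial j (f i) x)"
proof -
  have "((\<lambda>y. \<Sum>i\<in>A. c i * f i y) has_derivative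
      (\<lambda>v. \<Sum>i\<in>A. c i * frechet_derivative (f i) (at x) v)) (at x)"
    using assms by (auto intro!: derivative_intros simp: frechet_derivative_works[symmetric])
  then show ?thesis
    by (simp add: partial_def frechet_derivative_at[symmetric])
qed

lemma inner_matrix_vector_eq_sum:
  "a \<bullet> (A *v d) = (\<Sum>j\<in>UNIV. \<Sum>k\<in>UNIV. A $ j $ k * (a $ j * d $ k))" for A :: "real^'d^'d::finite"
  by (simp add: inner_vec_def matrix_vector_mult_def sum_distrib_left mult_ac)

text \<open>The Hessian matrix is defined by iterated partial derivatives; here it is seen to compute
  iterated directional derivatives, because a directional derivative is a linear combination of
  partial ones with constant coefficients.\<close>

lemma frechet_derivative2_eq_hessian:
  fixes \<phi> :: "real^'d::finite \<Rightarrow> real"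
  assumes "open U" "smooth_on U \<phi>" "x \<in> U"
  shows "frechet_derivative (\<lambda>y. frechet_derivative \<phi> (at y) c) (at x) a = a \<bullet> (hessian \<phi> x *v c)"
proof -
  let ?D = "\<lambda>y. frechet_derivative \<phi> (at y) c"
  have sm: "smooth_on U (partial k \<phi>)" for k
    using smooth_on_frechet_derivative[OF assms(2)] by (simp add: partial_def[abs_def])
  have diff: "?D differentiable (at x)"
    using assms smooth_on_frechet_derivative smooth_on_imp_differentiable by blast
  have "?D y = (\<Sum>k\<in>UNIV. c $ k * partial k \<phi> y)" if "y \<in> U" for y
    using smooth_on_imp_differentiable[OF assms(2) that] by (rule frechet_derivative_eq_sum_partial)
  then have "partial j ?D x = partial j (\<lambda>y. \<Sum>k\<in>UNIV. c $ k * partial k \<phi> y) x" for j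
    using diff by (rule partial_cong[OF assms(1,3)])
  then have "partial j ?D x = (\<Sum>k\<in>UNIV. c $ k * partial j (partial k \<phi>) x)" for j
    using smooth_on_imp_differentiable[OF sm assms(3)] by (simp add: partial_linear_combination)
  then show ?thesis
    by (simp add: frechet_derivative_eq_sum_partial[OF diff] inner_matrix_vector_eq_sum
        hessian_def sum_distrib_left mult_ac)
qed


section \<open>The three forms in block form\<close>

lemma uminus_matrix_vector_mult: "(- A) *v x = - (A *v x)" for A :: "real^'d^'e"
  by (simp add: vec_eq_iff matrix_vector_mult_def sum_negf)

lemma inner_matrix_vector_symmetric:
  "transpose A = A \<Longrightarrow> a \<bullet> (A *v d) = d \<bullet> (A *v a)" for A :: "real^'d^'d::finite"
  by (metis dot_lmul_matrix inner_commute vector_transpose_matrix)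

lemma inner_matrix_vector_antisymmetric:
  fixes A :: "real^'d^'d::finite"
  assumes "transpose A = - A"
  shows "a \<bullet> (A *v d) = - (d \<bullet> (A *v a))"
proof -
  have "a \<bullet> (A *v d) = (transpose A *v a) \<bullet> d"
    by (simp add: dot_lmul_matrix[symmetric])
  then show ?thesis using assms by (simp add: inner_commute uminus_matrix_vector_mult)
qed

lemma has_derivative_xc: "(xc j has_derivative xc j) (at p)"
  unfolding xc_def[abs_def]
  by (intro bounded_linear_imp_has_derivative bounded_linear_compose[OF bounded_linear_vec_nth]
      bounded_linear_fst)

lemma ext_d0_xc: "ext_d0 (xc j) p u = fst u $ j"
  by (simp add: ext_d0_def frechet_derivative_at[OF has_derivative_xc, symmetric] xc_def)

lemma has_derivative_yc: "(yc j has_derivative yc j) (at p)"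
  unfolding yc_def[abs_def]
  by (intro bounded_linear_imp_has_derivative bounded_linear_compose[OF bounded_linear_vec_nth]
      bounded_linear_snd)

lemma ext_d0_yc: "ext_d0 (yc j) p u = snd u $ j"
  by (simp add: ext_d0_def frechet_derivative_at[OF has_derivative_yc, symmetric] yc_def)

lemma ext_d0_zc: "ext_d0 (zc j) p u = zc j u"
proof -
  have "(zc j has_derivative zc j) (at p)"
    unfolding zc_def[abs_def]
    by (intro derivative_intros bounded_linear.has_derivative[OF bounded_linear_of_real]
        has_derivative_xc has_derivative_yc)
  then show ?thesis by (simp add: ext_d0_def frechet_derivative_at[symmetric])
qed

lemma omega1_eq_sum:
  "omega1 \<phi> p u v = (\<Sum>j\<in>UNIV. \<Sum>k\<in>UNIV.
     hessian \<phi> (fst p) $ j $ k * (fst u $ j * snd v $ k - fst v $ j * snd u $ k))"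
  by (simp add: omega1_def wedge_def ext_d0_xc ext_d0_yc)

lemma omega1_eq:
  "omega1 \<phi> p u v = fst u \<bullet> (hessian \<phi> (fst p) *v snd v) - fst v \<bullet> (hessian \<phi> (fst p) *v snd u)"
  by (simp add: omega1_eq_sum inner_matrix_vector_eq_sum right_diff_distrib sum_subtractf)

lemma omega23_eq:
  "omega23 om p u v = - (1 / 2) * (\<Sum>j\<in>UNIV. \<Sum>k\<in>UNIV.
     complex_of_real (om $ j $ k) * (zc j u * zc k v - zc j v * zc k u))"
  by (simp add: omega23_def wedge_def ext_d0_zc)

text \<open>In the next two evaluations the two halves of each wedge product agree by the antisymmetry of
  the coefficient matrix, which absorbs the factor \<open>1/2\<close> in \<open>omega23\<close>.\<close>

lemma omega2_eq:
  assumes "transpose om = - om"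
  shows "omega2 om p u v = snd u \<bullet> (om *v snd v) - fst u \<bullet> (om *v fst v)"
proof -
  have "omega2 om p u v = - (1 / 2) * ((fst u \<bullet> (om *v fst v) - snd u \<bullet> (om *v snd v))
      - (fst v \<bullet> (om *v fst u) - snd v \<bullet> (om *v snd u)))"
    unfolding inner_matrix_vector_eq_sum
    by (simp add: omega2_def omega23_eq Re_sum zc_def xc_def yc_def algebra_simps sum_subtractf
        sum.distrib)
  then show ?thesis
    using inner_matrix_vector_antisymmetric[OF assms, of "fst v" "fst u"]
      inner_matrix_vector_antisymmetric[OF assms, of "snd v" "snd u"] by (simp add: field_simps)
qed

lemma omega3_eq:
  assumes "transpose om = - om"
  shows "omega3 om p u v = - (fst u \<bullet> (om *v snd v)) - snd u \<bullet> (om *v fst v)"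
proof -
  have "omega3 om p u v = - (1 / 2) * ((fst u \<bullet> (om *v snd v) + snd u \<bullet> (om *v fst v))
      - (fst v \<bullet> (om *v snd u) + snd v \<bullet> (om *v fst u)))"
    unfolding inner_matrix_vector_eq_sum
    by (simp add: omega3_def omega23_eq Im_sum zc_def xc_def yc_def algebra_simps sum_subtractf
        sum.distrib)
  then show ?thesis
    using inner_matrix_vector_antisymmetric[OF assms, of "fst v" "snd u"]
      inner_matrix_vector_antisymmetric[OF assms, of "snd v" "fst u"] by (simp add: field_simps)
qed


section \<open>Symplecticity\<close>

lemma inner_matrix_vector_nondegenerate:
  fixes A :: "real^'d^'d::finite"
  assumes "invertible A" "\<And>d. d \<bullet> (A *v a) = 0"
  shows "a = 0"
proof -
  have "A *v a = 0" using assms(2)[of "A *v a"] by simp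
  then show ?thesis using assms(1) by (metis invertible_def matrix_left_invertible_ker)
qed

lemma bilinear_matrix_blocks:
  fixes A B C D :: "real^'d^'d::finite"
  shows "bilinear (\<lambda>u v. fst u \<bullet> (A *v fst v) + fst u \<bullet> (B *v snd v)
    + snd u \<bullet> (C *v fst v) + snd u \<bullet> (D *v snd v))"
  unfolding bilinear_def
  by (auto intro!: linearI simp: inner_add_left inner_add_right matrix_vector_right_distrib
      scalar_mult_eq_scaleR matrix_vector_mult_scaleR algebra_simps)

text \<open>Pairing \<open>(a, b)\<close> with vectors that have only an \<open>x\<close>-part or only a \<open>y\<close>-part isolates \<open>a\<close>
  and \<open>b\<close>; this is how nondegeneracy of each of the three forms reduces to invertibility of its
  coefficient matrix.\<close>

lemma symplectic_form_on_omega2: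
  assumes "transpose om = - om" "invertible om"
  shows "symplectic_form_on W (omega2 om)"
proof -
  note [simp] = omega2_eq[OF assms(1)]
  have nd: "u = 0" if "\<And>v. omega2 om p u v = 0" for p u
  proof (rule prod_eqI)
    show "fst u = fst 0"
      using that[of "(d, 0)" for d] inner_matrix_vector_antisymmetric[OF assms(1), of _ "fst u"]
      by (auto intro: inner_matrix_vector_nondegenerate[OF assms(2)])
    show "snd u = snd 0"
      using that[of "(0, d)" for d] inner_matrix_vector_antisymmetric[OF assms(1), of _ "snd u"]
      by (auto intro: inner_matrix_vector_nondegenerate[OF assms(2)])
  qed
  have "bilinear (omega2 om p)" for p
    using bilinear_matrix_blocks[of "-om" 0 0 om]
    by (simp add: uminus_matrix_vector_mult omega2_eq[OF assms(1), abs_def])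
  moreover have "omega2 om p u u = 0" for p u
    using inner_matrix_vector_antisymmetric[OF assms(1), of "fst u" "fst u"]
      inner_matrix_vector_antisymmetric[OF assms(1), of "snd u" "snd u"] by simp
  ultimately show ?thesis
    using nd by (auto simp: symplectic_form_on_def ext_d2_def smooth_on_const)
qed

lemma symplectic_form_on_omega3:
  assumes "transpose om = - om" "invertible om"
  shows "symplectic_form_on W (omega3 om)"
proof -
  note [simp] = omega3_eq[OF assms(1)]
  have nd: "u = 0" if "\<And>v. omega3 om p u v = 0" for p u
  proof (rule prod_eqI)
    show "fst u = fst 0"
      using that[of "(0, d)" for d] inner_matrix_vector_antisymmetric[OF assms(1), of _ "fst u"]
      by (auto intro: inner_matrix_vector_nondegenerate[OF assms(2)])
    show "snd u = snd 0"
      using that[of "(d, 0)" for d] inner_matrix_vector_antisymmetric[OF assms(1), of _ "snd u"]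
      by (auto intro: inner_matrix_vector_nondegenerate[OF assms(2)])
  qed
  have "bilinear (omega3 om p)" for p
    using bilinear_matrix_blocks[of 0 "-om" "-om" 0]
    by (simp add: uminus_matrix_vector_mult omega3_eq[OF assms(1), abs_def])
  moreover have "omega3 om p u u = 0" for p u
    using inner_matrix_vector_antisymmetric[OF assms(1), of "fst u" "snd u"] by simp
  ultimately show ?thesis
    using nd by (auto simp: symplectic_form_on_def ext_d2_def smooth_on_const)
qed

text \<open>The derivative of \<open>a \<bullet> (hessian \<phi> x *v d)\<close> in direction \<open>e\<close>.  The outermost sum runs over
  the last index so that exchanging the two inner sums exchanges the roles of \<open>e\<close> and \<open>a\<close>.\<close>

definition hessian_deriv :: "(real^'d::finite \<Rightarrow> real) \<Rightarrow> real^'d \<Rightarrow> real^'d \<Rightarrow> real^'d \<Rightarrow> real^'d \<Rightarrow> real"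
  where "hessian_deriv \<phi> x e a d =
    (\<Sum>k\<in>UNIV. \<Sum>j\<in>UNIV. \<Sum>l\<in>UNIV. partial l (\<lambda>y. hessian \<phi> y $ j $ k) x * (e $ l * a $ j * d $ k))"

lemma frechet_derivative_omega1:
  assumes "\<And>j k. (\<lambda>x. hessian \<phi> x $ j $ k) differentiable (at (fst p))"
  shows "frechet_derivative (\<lambda>q. omega1 \<phi> q u v) (at p) s
    = hessian_deriv \<phi> (fst p) (fst s) (fst u) (snd v) - hessian_deriv \<phi> (fst p) (fst s) (fst v) (snd u)"
proof -
  have "((\<lambda>q. hessian \<phi> (fst q) $ j $ k) has_derivative
      (\<lambda>s. frechet_derivative (\<lambda>x. hessian \<phi> x $ j $ k) (at (fst p)) (fst s))) (at p)" for j k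
    by (rule has_derivative_compose[OF has_derivative_fst[OF has_derivative_ident]])
       (simp add: assms frechet_derivative_works[symmetric])
  then have "((\<lambda>q. omega1 \<phi> q u v) has_derivative
      (\<lambda>s. \<Sum>j\<in>UNIV. \<Sum>k\<in>UNIV.
        frechet_derivative (\<lambda>x. hessian \<phi> x $ j $ k) (at (fst p)) (fst s)
          * (fst u $ j * snd v $ k - fst v $ j * snd u $ k))) (at p)"
    unfolding omega1_eq_sum by (intro has_derivative_sum has_derivative_mult_left)
  then have "frechet_derivative (\<lambda>q. omega1 \<phi> q u v) (at p) s = (\<Sum>j\<in>UNIV. \<Sum>k\<in>UNIV.
        frechet_derivative (\<lambda>x. hessian \<phi> x $ j $ k) (at (fst p)) (fst s)
          * (fst u $ j * snd v $ k - fst v $ j * snd u $ k))"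
    by (simp add: frechet_derivative_at[symmetric])
  also have "\<dots> = (\<Sum>k\<in>UNIV. \<Sum>j\<in>UNIV. \<Sum>l\<in>UNIV.
      partial l (\<lambda>x. hessian \<phi> x $ j $ k) (fst p)
        * (fst s $ l * fst u $ j * snd v $ k - fst s $ l * fst v $ j * snd u $ k))"
    unfolding frechet_derivative_eq_sum_partial[OF assms] sum_distrib_right
    by (subst sum.swap) (simp add: algebra_simps)
  also have "\<dots> = hessian_deriv \<phi> (fst p) (fst s) (fst u) (snd v)
      - hessian_deriv \<phi> (fst p) (fst s) (fst v) (snd u)"
    by (simp add: hessian_deriv_def right_diff_distrib sum_subtractf)
  finally show ?thesis .
qed

text \<open>Because \<open>om\<close> is constant, differentiating \<open>G = om ** Ic\<close> transfers the vanishing of the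
  covariant exterior derivative from \<open>Ic\<close> to \<open>G\<close>.  The symmetry of \<open>G\<close> serves to
  put \<open>j\<close>, instead of \<open>k\<close>, in the position of the form index of \<open>Ic\<close>.\<close>

lemma codazzi:
  fixes G Ic :: "real^'d::finite \<Rightarrow> real^'d^'d"
  assumes "open U" "x \<in> U"
    and sym: "\<And>y. y \<in> U \<Longrightarrow> transpose (G y) = G y"
    and G: "\<And>y. y \<in> U \<Longrightarrow> G y = om ** Ic y"
    and diff: "\<And>j k. (\<lambda>y. Ic y $ j $ k) differentiable (at x)"
    and flat: "\<And>j k l. partial k (\<lambda>y. Ic y $ j $ l) x = partial l (\<lambda>y. Ic y $ j $ k) x"
  shows "partial l (\<lambda>y. G y $ j $ k) x = partial j (\<lambda>y. G y $ l $ k) x"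
proof -
  have "(\<Sum>m\<in>UNIV. om $ k $ m * Ic y $ m $ j) = G y $ j $ k" if "y \<in> U" for y j k
  proof -
    have "G y $ j $ k = transpose (G y) $ j $ k"
      using sym[OF that] by simp
    also have "\<dots> = (\<Sum>m\<in>UNIV. om $ k $ m * Ic y $ m $ j)"
      by (simp add: G[OF that] transpose_def matrix_matrix_mult_def)
    finally show ?thesis by simp
  qed
  then have "partial l (\<lambda>y. \<Sum>m\<in>UNIV. om $ k $ m * Ic y $ m $ j) x = partial l (\<lambda>y. G y $ j $ k) x"
    for l j k
    by (rule partial_cong[OF assms(1,2)]) (auto intro!: derivative_intros diff)
  then have "partial l (\<lambda>y. G y $ j $ k) x = (\<Sum>m\<in>UNIV. om $ k $ m * partial l (\<lambda>y. Ic y $ m $ j) x)"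
    for l j k
    by (simp add: partial_linear_combination diff)
  then show ?thesis by (simp add: flat[of l _ j])
qed

lemma hessian_deriv_swap:
  assumes "\<And>j k l. partial l (\<lambda>y. hessian \<phi> y $ j $ k) x = partial j (\<lambda>y. hessian \<phi> y $ l $ k) x"
  shows "hessian_deriv \<phi> x e a d = hessian_deriv \<phi> x a e d"
proof -
  have "hessian_deriv \<phi> x e a d = (\<Sum>k\<in>UNIV. \<Sum>l\<in>UNIV. \<Sum>j\<in>UNIV.
      partial l (\<lambda>y. hessian \<phi> y $ j $ k) x * (e $ l * a $ j * d $ k))"
    unfolding hessian_deriv_def by (rule sum.cong[OF refl sum.swap])
  also have "\<dots> = hessian_deriv \<phi> x a e d"
    unfolding hessian_deriv_def
    by (intro sum.cong refl) (subst assms, simp add: mult_ac)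
  finally show ?thesis .
qed

text \<open>The six terms of the exterior derivative cancel in pairs: both terms that contain a given one
  of the three \<open>y\<close>-components have it in the last slot of the derivative of the Hessian, and they
  differ by an exchange of the first two slots.\<close>

lemma symplectic_form_on_omega1:
  fixes \<phi> :: "real^'d::finite \<Rightarrow> real"
  assumes "open U"
    and sm: "\<And>j k. smooth_on U (\<lambda>x. hessian \<phi> x $ j $ k)"
    and sym: "\<And>x. x \<in> U \<Longrightarrow> transpose (hessian \<phi> x) = hessian \<phi> x"
    and inv: "\<And>x. x \<in> U \<Longrightarrow> invertible (hessian \<phi> x)"
    and codazzi: "\<And>x j k l. x \<in> U \<Longrightarrow>
      partial l (\<lambda>y. hessian \<phi> y $ j $ k) x = partial j (\<lambda>y. hessian \<phi> y $ l $ k) x"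
  shows "symplectic_form_on (U \<times> UNIV) (omega1 \<phi>)"
  unfolding symplectic_form_on_def
proof (intro conjI allI ballI impI)
  have o: "open (U \<times> (UNIV :: (real^'d) set))" using \<open>open U\<close> by (simp add: open_Times)
  show "smooth_on (U \<times> UNIV) (\<lambda>p. omega1 \<phi> p u v)" for u v
    unfolding omega1_eq_sum
    by (intro smooth_on_sum[OF o] smooth_on_bounded_linear[OF o bounded_linear_mult_left]
        smooth_on_comp_fst[OF \<open>open U\<close>] sm)
next
  fix p assume p: "p \<in> U \<times> (UNIV :: (real^'d) set)"
  then have x: "fst p \<in> U" by auto
  note G = inner_matrix_vector_symmetric[OF sym[OF x]]
  have "omega1 \<phi> p = (\<lambda>u v. fst u \<bullet> (hessian \<phi> (fst p) *v snd v)
      - snd u \<bullet> (hessian \<phi> (fst p) *v fst v))"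
    using G by (auto simp: omega1_eq fun_eq_iff)
  then show "bilinear (omega1 \<phi> p)"
    using bilinear_matrix_blocks[of 0 "hessian \<phi> (fst p)" "- hessian \<phi> (fst p)" 0]
    by (simp add: uminus_matrix_vector_mult)
  show "omega1 \<phi> p u u = 0" for u by (simp add: omega1_eq)
  show "u = 0" if "\<forall>v. omega1 \<phi> p u v = 0" for u
  proof (rule prod_eqI)
    show "fst u = fst 0"
      using that[rule_format, of "(0, d)" for d] G[of _ "fst u"]
      by (auto intro!: inner_matrix_vector_nondegenerate[OF inv[OF x]] simp: omega1_eq)
    show "snd u = snd 0"
      using that[rule_format, of "(d, 0)" for d]
      by (auto intro!: inner_matrix_vector_nondegenerate[OF inv[OF x]] simp: omega1_eq)
  qed
  note T = hessian_deriv_swap[OF codazzi[OF x]]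
  show "ext_d2 (omega1 \<phi>) p s u v = 0" for s u v
    using T[of "fst s" "fst u" "snd v"] T[of "fst s" "fst v" "snd u"] T[of "fst u" "fst v" "snd s"]
    by (simp add: ext_d2_def frechet_derivative_omega1 smooth_on_imp_differentiable[OF sm x])
qed


section \<open>The quaternionic structure\<close>

text \<open>Here \<open>form_endo s t p\<close> is built with \<open>inv (s p)\<close>, the inverse as a function into all functions
  on tangent vectors.  Injectivity of \<open>s p\<close> makes it a genuine inverse on the range, so
  each \<open>form_endo\<close> is found by exhibiting a solution of the equation defining it.\<close>

lemma symplectic_form_on_imp_inj:
  assumes "symplectic_form_on W w" "p \<in> W"
  shows "inj (w p)"
proof (rule injI)
  fix u u' assume eq: "w p u = w p u'"
  have "bilinear (w p)" using assms by (simp add: symplectic_form_on_def)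
  then have "w p (u - u') v = 0" for v using eq by (simp add: bilinear_lsub)
  then have "u - u' = 0" using assms unfolding symplectic_form_on_def by blast
  then show "u = u'" by simp
qed

lemma form_endo_eqI:
  assumes "inj (s p)" "\<And>u v. s p (J u) v = t p u v"
  shows "form_endo s t p = J"
proof
  fix u
  have "t p u = s p (J u)" using assms(2) by auto
  then show "form_endo s t p u = J u" using assms(1) by (simp add: form_endo_def)
qed

lemma form_endo_omega3_omega2:
  assumes "transpose om = - om" "invertible om"
  shows "form_endo (omega3 om) (omega2 om) = (\<lambda>p u. (- snd u, fst u))"
proof
  fix p
  show "form_endo (omega3 om) (omega2 om) p = (\<lambda>u. (- snd u, fst u))"
    by (rule form_endo_eqI)
       (simp_all add: symplectic_form_on_imp_inj[OF symplectic_form_on_omega3[OF assms] UNIV_I]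
          omega2_eq[OF assms(1)] omega3_eq[OF assms(1)])
qed

lemma quaternionic_special_kaehler:
  fixes I :: "real^'d^'d::finite"
  assumes "I ** I = - mat 1"
  shows "quaternionic (\<lambda>u. (- snd u, fst u)) (\<lambda>u. (- (I *v fst u), I *v snd u))
    (\<lambda>u. (- (I *v snd u), - (I *v fst u)))"
proof -
  have "I *v (I *v a) = - a" for a
    by (simp add: matrix_vector_mul_assoc assms uminus_matrix_vector_mult)
  moreover have "I *v (- a) = - (I *v a)" for a
    by (simp add: vec_eq_iff matrix_vector_mult_def sum_negf)
  ultimately show ?thesis by (simp add: quaternionic_def fun_eq_iff)
qed

text \<open>The identity \<open>\<omega>(X, Y) = g(I X, Y)\<close> on which the computation of \<open>J\<^sub>2\<close> and \<open>J\<^sub>3\<close> rests.\<close>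

lemma special_kaehler_pairing:
  fixes I G om :: "real^'d^'d::finite"
  assumes "om = transpose I ** G"
  shows "(I *v a) \<bullet> (G *v d) = a \<bullet> (om *v d)"
  by (metis assms dot_lmul_matrix matrix_vector_mul_assoc transpose_matrix_vector inner_commute
      transpose_transpose)


section \<open>The Kaehler potential\<close>

lemma dbar_fun_eq:
  assumes "\<phi> differentiable (at (fst q))"
  shows "dbar_fun (\<lambda>p u. (- snd u, fst u)) (\<lambda>q. complex_of_real (\<phi> (fst q))) q v =
    (complex_of_real (frechet_derivative \<phi> (at (fst q)) (fst v))
      - \<i> * complex_of_real (frechet_derivative \<phi> (at (fst q)) (snd v))) / 2"
proof -
  interpret linear "frechet_derivative \<phi> (at (fst q))"
    using assms by (rule linear_frechet_derivative)
  have "((\<lambda>q. complex_of_real (\<phi> (fst q))) has_derivative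
      (\<lambda>v. complex_of_real (frechet_derivative \<phi> (at (fst q)) (fst v)))) (at q)"
    by (intro bounded_linear.has_derivative[OF bounded_linear_of_real]
        has_derivative_compose[OF has_derivative_fst[OF has_derivative_ident]])
       (simp add: assms frechet_derivative_works[symmetric])
  then show ?thesis
    by (simp add: dbar_fun_def part_01_def ext_d0_def frechet_derivative_at[symmetric] neg)
qed

text \<open>All second derivatives of \<open>\<phi>\<close> enter through the Hessian, whose symmetry cancels the real
  part of the exterior derivative and makes \<open>omega1\<close> invariant under \<open>J\<close>; hence taking
  the (1,1)-part changes nothing.\<close>

lemma del_01_dbar_fun_eq:
  fixes \<phi> :: "real^'d::finite \<Rightarrow> real"
  assumes "open U" "smooth_on U \<phi>" "fst p \<in> U"
    and sym: "transpose (hessian \<phi> (fst p)) = hessian \<phi> (fst p)"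
  defines "J \<equiv> (\<lambda>p u. (- snd u, fst u))"
  shows "del_01 J (dbar_fun J (\<lambda>q. complex_of_real (\<phi> (fst q)))) p u v
    = - \<i> / 2 * complex_of_real (omega1 \<phi> p u v)"
proof -
  let ?H = "hessian \<phi> (fst p)"
  let ?b = "dbar_fun J (\<lambda>q. complex_of_real (\<phi> (fst q)))"
  have o: "open (U \<times> (UNIV :: (real^'d) set))" using \<open>open U\<close> by (simp add: open_Times)
  have p: "p \<in> U \<times> UNIV" using assms(3) by (simp add: mem_Times_iff)
  have "((\<lambda>q. frechet_derivative \<phi> (at (fst q)) c) has_derivative (\<lambda>a. fst a \<bullet> (?H *v c))) (at p)" for c
  proof -
    have "(\<lambda>y. frechet_derivative \<phi> (at y) c) differentiable (at (fst p))"
      using smooth_on_imp_differentiable[OF smooth_on_frechet_derivative[OF assms(2)] assms(3)] .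
    then have "((\<lambda>y. frechet_derivative \<phi> (at y) c) has_derivative (\<lambda>a. a \<bullet> (?H *v c))) (at (fst p))"
      unfolding frechet_derivative_works frechet_derivative2_eq_hessian[OF assms(1-3)] .
    from has_derivative_compose[OF has_derivative_fst[OF has_derivative_ident] this]
    show ?thesis .
  qed
  then have "((\<lambda>q. (complex_of_real (frechet_derivative \<phi> (at (fst q)) (fst v))
        - \<i> * complex_of_real (frechet_derivative \<phi> (at (fst q)) (snd v))) / 2) has_derivative
      (\<lambda>u. (complex_of_real (fst u \<bullet> (?H *v fst v)) - \<i> * complex_of_real (fst u \<bullet> (?H *v snd v))) / 2)) (at p)"
    for v
    by (intro bounded_linear.has_derivative[OF bounded_linear_divide] has_derivative_diff
        has_derivative_mult_right bounded_linear.has_derivative[OF bounded_linear_of_real])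
  then have "((\<lambda>q. ?b q v) has_derivative
      (\<lambda>u. (complex_of_real (fst u \<bullet> (?H *v fst v)) - \<i> * complex_of_real (fst u \<bullet> (?H *v snd v))) / 2)) (at p)"
    for v
    by (rule has_derivative_transform_within_open[OF _ o p])
       (auto simp: J_def dbar_fun_eq smooth_on_imp_differentiable[OF assms(2)])
  from frechet_derivative_at[OF this, symmetric]
  have "frechet_derivative (\<lambda>q. ?b q v) (at p) u =
      (complex_of_real (fst u \<bullet> (?H *v fst v)) - \<i> * complex_of_real (fst u \<bullet> (?H *v snd v))) / 2" for u v
    by simp
  then have "ext_d1 ?b p u v = - \<i> / 2 * complex_of_real (omega1 \<phi> p u v)" for u v
    using inner_matrix_vector_symmetric[OF sym, of "fst v" "fst u"]
    by (simp add: ext_d1_def omega1_eq field_simps)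
  moreover have "omega1 \<phi> p (J p u) (J p v) = omega1 \<phi> p u v"
    using inner_matrix_vector_symmetric[OF sym, of "snd u" "fst v"]
      inner_matrix_vector_symmetric[OF sym, of "snd v" "fst u"]
    by (simp add: omega1_eq J_def)
  ultimately show ?thesis by (simp add: del_01_def part_11_def)
qed

theorem proposition4:
  fixes U :: "(real^('n::finite + 'n)) set"
    and Ic g :: "real^('n + 'n) \<Rightarrow> real^('n + 'n)^('n + 'n)"
    and om :: "real^('n + 'n)^('n + 'n)"
    and \<phi> :: "real^('n + 'n) \<Rightarrow> real"
  assumes "special_pseudo_kaehler_on U Ic g om"
    and "smooth_on U \<phi>"
    and "\<And>x. x \<in> U \<Longrightarrow> g x = hessian \<phi> x"
  shows "pseudo_hyperkaehler_forms_on (U \<times> UNIV) (omega1 \<phi>) (omega2 om) (omega3 om) \<and>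
    (\<exists>c::real. c \<noteq> 0 \<and>
      (\<forall>p \<in> U \<times> UNIV. \<forall>u v.
        complex_of_real (omega1 \<phi> p u v) =
          complex_of_real c *
          (\<i> * del_01 (form_endo (omega3 om) (omega2 om))
                (dbar_fun (form_endo (omega3 om) (omega2 om))
                  (\<lambda>q. complex_of_real (\<phi> (fst q)))) p u v)))"
proof
  have U: "open U" and om: "transpose om = - om" "invertible om"
    and smI: "\<And>j k. smooth_on U (\<lambda>x. Ic x $ j $ k)"
    and flat: "\<And>x j k l. x \<in> U \<Longrightarrow>
      partial k (\<lambda>y. Ic y $ j $ l) x = partial l (\<lambda>y. Ic y $ j $ k) x"
    using assms(1) by (auto simp: special_pseudo_kaehler_on_def complex_structure_on_def)
  have smg: "smooth_on U (\<lambda>x. g x $ j $ k)" for j k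
    using assms(1) by (auto simp: special_pseudo_kaehler_on_def hermitian_pseudo_metric_on_def)
  have sm: "smooth_on U (\<lambda>x. hessian \<phi> x $ j $ k)" for j k
    by (rule smooth_on_cong[OF U _ smg[of j k]]) (simp add: assms(3))
  have sym: "transpose (hessian \<phi> x) = hessian \<phi> x" and inv: "invertible (hessian \<phi> x)"
    and omI: "om = transpose (Ic x) ** hessian \<phi> x" and I2: "Ic x ** Ic x = - mat 1"
    and hess: "hessian \<phi> x = om ** Ic x" if "x \<in> U" for x
    using assms(1,3) that
    by (auto simp: special_pseudo_kaehler_on_def hermitian_pseudo_metric_on_def
        complex_structure_on_def)
  have w1: "symplectic_form_on (U \<times> UNIV) (omega1 \<phi>)"
    using codazzi[OF U _ sym hess smooth_on_imp_differentiable[OF smI] flat]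
    by (intro symplectic_form_on_omega1[OF U sm sym inv])
  note w2 = symplectic_form_on_omega2[OF om, of UNIV] and w3 = symplectic_form_on_omega3[OF om]
  have "quaternionic (form_endo (omega3 om) (omega2 om) p) (form_endo (omega1 \<phi>) (omega3 om) p)
      (form_endo (omega2 om) (omega1 \<phi>) p)" if p: "p \<in> U \<times> UNIV" for p
  proof -
    have x: "fst p \<in> U" using p by auto
    let ?I = "Ic (fst p)" and ?G = "hessian \<phi> (fst p)"
    note pair = special_kaehler_pairing[OF omI[OF x]]
    have II: "?I *v (?I *v a) = - a" for a
      by (simp add: matrix_vector_mul_assoc I2[OF x] uminus_matrix_vector_mult)
    \<comment> \<open>the pairing identity at \<open>I a\<close>, since \<open>I\<close> squares to \<open>-1\<close>\<close>
    have pair': "(?I *v a) \<bullet> (om *v d) = - (a \<bullet> (?G *v d))" for a d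
      using pair[of "?I *v a" d] by (simp add: II)
    note symG = inner_matrix_vector_symmetric[OF sym[OF x]]
    have J2: "form_endo (omega1 \<phi>) (omega3 om) p = (\<lambda>u. (- (?I *v fst u), ?I *v snd u))"
    proof (rule form_endo_eqI[where s = "omega1 \<phi>" and p = p, OF symplectic_form_on_imp_inj[OF w1 p]])
      show "omega1 \<phi> p (- (?I *v fst u), ?I *v snd u) v = omega3 om p u v" for u v
        using symG[of "fst v" "?I *v snd u"]
        by (simp add: omega1_eq omega3_eq[OF om(1)] pair)
    qed
    have J3: "form_endo (omega2 om) (omega1 \<phi>) p = (\<lambda>u. (- (?I *v snd u), - (?I *v fst u)))"
    proof (rule form_endo_eqI[where s = "omega2 om" and p = p, OF symplectic_form_on_imp_inj[OF w2 UNIV_I]])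
      show "omega2 om p (- (?I *v snd u), - (?I *v fst u)) v = omega1 \<phi> p u v" for u v
        using symG[of "fst v" "snd u"]
        by (simp add: omega1_eq omega2_eq[OF om(1)] pair')
    qed
    show ?thesis
      using quaternionic_special_kaehler[OF I2[OF x]] by (simp add: form_endo_omega3_omega2[OF om] J2 J3)
  qed
  then show "pseudo_hyperkaehler_forms_on (U \<times> UNIV) (omega1 \<phi>) (omega2 om) (omega3 om)"
    using w1 symplectic_form_on_omega2[OF om] w3 by (simp add: pseudo_hyperkaehler_forms_on_def)
  have "complex_of_real (omega1 \<phi> p u v) = complex_of_real 2 *
      (\<i> * del_01 (form_endo (omega3 om) (omega2 om)) (dbar_fun (form_endo (omega3 om) (omega2 om))
        (\<lambda>q. complex_of_real (\<phi> (fst q)))) p u v)" if "p \<in> U \<times> UNIV" for p u v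
  proof -
    have "fst p \<in> U" using that by auto
    then show ?thesis
      by (simp add: form_endo_omega3_omega2[OF om] del_01_dbar_fun_eq[OF U assms(2) _ sym])
  qed
  then show "\<exists>c::real. c \<noteq> 0 \<and>
      (\<forall>p \<in> U \<times> UNIV. \<forall>u v.
        complex_of_real (omega1 \<phi> p u v) =
          complex_of_real c *
          (\<i> * del_01 (form_endo (omega3 om) (omega2 om))
                (dbar_fun (form_endo (omega3 om) (omega2 om))
                  (\<lambda>q. complex_of_real (\<phi> (fst q)))) p u v))"
    by (intro exI[of _ 2]) simp
qed

end
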